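(* Let $\kappa$ be a regular uncountable cardinal, let $I$ be an ideal on $\kappa$, let $\gamma<\kappa$ be a limit ordinal, and let $\mathbb Q$ be a poset with domain $Q$. Then the following hold: (1) Empty has a winning strategy in $\mathcal B(I,\gamma)$ if and only if Cut has a winning strategy in $\mathcal G_\infty(X,I,{\le}\gamma)$ for some $X\in I^+$. (2) Empty has a winning strategy in $\mathcal B(\mathbb Q,\gamma)$ if and only if Cut has a winning strategy in $\mathcal G_\infty(X,\mathbb Q,\gamma)$ for some $X\in Q$.
   Context: $I^+$ denotes the collection of subsets of $\kappa$ not in $I$ (the $I$-positive sets). For $X\in I^+$, an $I$-partition of $X$ is a maximal collection $W\subseteq P(X)\cap I^+$ such that $A\cap B\in I$ whenever $A,B\in W$ are distinct. Posets are assumed to have a maximal element. Banach-Mazur games. $\mathcal B(I,\gamma)$ has length $\gamma$: players Empty and Nonempty take turns to play $I$-positive sets, forming a $\subseteq$-decreasing sequence, with Empty starting the game and with Nonempty playing first at each limit stage. If at any limit stage $\delta<\gamma$ Nonempty cannot make a valid move, then Empty wins and the game ends. Nonempty wins if the game proceeds for $\gamma$ many rounds and the intersection of the sets that were played is nonempty; otherwise Empty wins. $\mathcal B(\mathbb Q,\gamma)$ is played in the same way, with the players playing elements of $Q$ forming a $\le$-decreasing sequence; Nonempty wins if the game proceeds for $\gamma$ many rounds and the collection of elements that were played has a lower bound in $Q$, and otherwise Empty wins. Cut and choose games. $\mathcal G_\infty(X,I,{\le}\gamma)$ has $\gamma$ many rounds: in each round, Cut plays an $I$-partition of $X$ (of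 arbitrary size), and Choose picks one of its elements. Choose wins if for all $\delta<\gamma$ the intersection of their choices up to stage $\delta$ is $I$-positive and the intersection of all their $\gamma$ many choices is nonempty; otherwise Cut wins. $\mathcal G_\infty(X,\mathbb Q,\gamma)$ has $\gamma$ many rounds: in each round, Cut plays a maximal antichain of $\mathbb Q$ below $X$ (of arbitrary size), and Choose picks one of its elements. Choose wins if the sequence of all of their choices has a lower bound in $\mathbb Q$; otherwise Cut wins. *)

theory Defs
  imports Main "HOL-Library.FuncSet"
begin

unbundle cardinal_syntax

section \<open>Ordinals below a cardinal\<close>

text \<open>
  A cardinal is a well-ordered type \<open>'k\<close> whose order relation is a cardinal order. Subsets of
  the cardinal are then of type \<open>'k set\<close>, and the elements of \<open>'k\<close> are the smaller ordinals.
\<close>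

abbreviation type_order :: "'k::wellorder rel" where
  "type_order \<equiv> {(x, y). x \<le> y}"

text \<open>Zero does not count as a limit.\<close>

definition limit_ordinal :: "'k::wellorder \<Rightarrow> bool" where
  "limit_ordinal \<delta> \<longleftrightarrow> (\<exists>\<beta>. \<beta> < \<delta>) \<and> (\<forall>\<beta><\<delta>. \<exists>\<xi>. \<beta> < \<xi> \<and> \<xi> < \<delta>)"

definition successor_of :: "'k::wellorder \<Rightarrow> 'k \<Rightarrow> bool" where
  "successor_of \<beta> \<alpha> \<longleftrightarrow> \<beta> < \<alpha> \<and> (\<forall>\<xi>>\<beta>. \<alpha> \<le> \<xi>)"


section \<open>Ideals, partitions and antichains\<close>

text \<open>
  Neither properness nor any completeness is imposed, so this notion also covers the
  narrower conventions. If the ideal is improper, there are no positive sets at all.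
\<close>

definition set_ideal :: "'k set set \<Rightarrow> bool" where
  "set_ideal I \<longleftrightarrow> {} \<in> I \<and> (\<forall>A\<in>I. \<forall>B. B \<subseteq> A \<longrightarrow> B \<in> I) \<and> (\<forall>A\<in>I. \<forall>B\<in>I. A \<union> B \<in> I)"

definition positive_sets :: "'k set set \<Rightarrow> 'k set set" where
  "positive_sets I = {A. A \<notin> I}"

definition almost_disjoint_family :: "'k set set \<Rightarrow> 'k set \<Rightarrow> 'k set set \<Rightarrow> bool" where
  "almost_disjoint_family I X W \<longleftrightarrow>
     W \<subseteq> Pow X \<inter> positive_sets I \<and> (\<forall>A\<in>W. \<forall>B\<in>W. A \<noteq> B \<longrightarrow> A \<inter> B \<in> I)"

definition ideal_partition :: "'k set set \<Rightarrow> 'k set \<Rightarrow> 'k set set \<Rightarrow> bool" where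
  "ideal_partition I X W \<longleftrightarrow>
     almost_disjoint_family I X W \<and>
     (\<forall>W'. almost_disjoint_family I X W' \<and> W \<subseteq> W' \<longrightarrow> W' = W)"

text \<open>
  For a partial order \<open>r\<close>, the pair \<open>(p, q) \<in> r\<close> means that \<open>p\<close> is below \<open>q\<close>. Antichains are meant
  in the sense of forcing: distinct elements are incompatible, not merely incomparable.
\<close>

definition compatible :: "'q set \<Rightarrow> 'q rel \<Rightarrow> 'q \<Rightarrow> 'q \<Rightarrow> bool" where
  "compatible Q r p q \<longleftrightarrow> (\<exists>s\<in>Q. (s, p) \<in> r \<and> (s, q) \<in> r)"

definition antichain_below :: "'q set \<Rightarrow> 'q rel \<Rightarrow> 'q \<Rightarrow> 'q set \<Rightarrow> bool" where
  "antichain_below Q r X W \<longleftrightarrow>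
     W \<subseteq> {p \<in> Q. (p, X) \<in> r} \<and> (\<forall>p\<in>W. \<forall>q\<in>W. p \<noteq> q \<longrightarrow> \<not> compatible Q r p q)"

definition max_antichain_below :: "'q set \<Rightarrow> 'q rel \<Rightarrow> 'q \<Rightarrow> 'q set \<Rightarrow> bool" where
  "max_antichain_below Q r X W \<longleftrightarrow>
     antichain_below Q r X W \<and>
     (\<forall>W'. antichain_below Q r X W' \<and> W \<subseteq> W' \<longrightarrow> W' = W)"


section \<open>Banach-Mazur games\<close>

text \<open>
  One move is made at each stage. As the length \<open>\<gamma>\<close> is a limit ordinal, it makes no difference
  whether \<open>\<gamma>\<close> counts single moves or rounds consisting of one move of each player.
\<close>

inductive empty_turn nonempty_turn :: "'k::wellorder \<Rightarrow> bool" where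
  start: "(\<And>\<beta>. \<alpha> \<le> \<beta>) \<Longrightarrow> empty_turn \<alpha>"
| limit: "limit_ordinal \<alpha> \<Longrightarrow> nonempty_turn \<alpha>"
| after_empty: "empty_turn \<beta> \<Longrightarrow> successor_of \<beta> \<alpha> \<Longrightarrow> nonempty_turn \<alpha>"
| after_nonempty: "nonempty_turn \<beta> \<Longrightarrow> successor_of \<beta> \<alpha> \<Longrightarrow> empty_turn \<alpha>"

lemma successor_of_unique: "successor_of \<beta> \<alpha> \<Longrightarrow> successor_of \<beta>' \<alpha> \<Longrightarrow> \<beta>' = \<beta>"
  unfolding successor_of_def by (meson leD linorder_less_linear)

lemma not_limit_ordinal_successor: "successor_of \<beta> \<alpha> \<Longrightarrow> \<not> limit_ordinal \<alpha>"
  unfolding successor_of_def limit_ordinal_def by (meson leD)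

lemma ordinal_cases:
  obtains "\<And>\<beta>. (\<alpha>::'k::wellorder) \<le> \<beta>" | "limit_ordinal \<alpha>" | \<beta> where "successor_of \<beta> \<alpha>"
  unfolding successor_of_def limit_ordinal_def by (meson leI)

lemma nonempty_turn_iff: "nonempty_turn \<alpha> \<longleftrightarrow> \<not> empty_turn (\<alpha>::'k::wellorder)"
proof (induction \<alpha> rule: less_induct)
  case (less \<alpha>)
  show ?case
  proof (cases \<alpha> rule: ordinal_cases)
    case 1
    then have "\<not> limit_ordinal \<alpha>" "\<And>\<beta>. \<not> successor_of \<beta> \<alpha>"
      by (auto simp: limit_ordinal_def successor_of_def dest: leD)
    then show ?thesis using 1 by (auto intro: start elim: nonempty_turn.cases)
  next
    case 2
    then have "\<not> (\<forall>\<beta>. \<alpha> \<le> \<beta>)" by (auto simp: limit_ordinal_def not_le)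
    moreover have "\<And>\<beta>. \<not> successor_of \<beta> \<alpha>" using 2 not_limit_ordinal_successor by blast
    ultimately show ?thesis using 2 by (auto intro: limit elim: empty_turn.cases)
  next
    case (3 \<beta>)
    then have lt: "\<beta> < \<alpha>" and "\<not> (\<forall>\<beta>. \<alpha> \<le> \<beta>)"
      by (auto simp: successor_of_def not_le)
    then have "empty_turn \<alpha> \<longleftrightarrow> nonempty_turn \<beta>"
      using 3 successor_of_unique by (metis after_nonempty empty_turn.cases)
    moreover have "nonempty_turn \<alpha> \<longleftrightarrow> empty_turn \<beta>"
      using 3 successor_of_unique not_limit_ordinal_successor
      by (metis after_empty nonempty_turn.cases)
    ultimately show ?thesis using less.IH[OF lt] by blast
  qed
qed

definition bm_valid_move :: "'a set \<Rightarrow> 'a rel \<Rightarrow> 'k::wellorder \<Rightarrow> ('k \<Rightarrow> 'a) \<Rightarrow> 'a \<Rightarrow> bool" where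
  "bm_valid_move Q r \<alpha> p x \<longleftrightarrow> x \<in> Q \<and> (\<forall>\<xi><\<alpha>. (x, p \<xi>) \<in> r)"

definition bm_position :: "'a set \<Rightarrow> 'a rel \<Rightarrow> 'k::wellorder \<Rightarrow> ('k \<Rightarrow> 'a) \<Rightarrow> bool" where
  "bm_position Q r \<alpha> p \<longleftrightarrow> (\<forall>\<beta><\<alpha>. bm_valid_move Q r \<beta> p (p \<beta>))"

text \<open>
  A strategy \<open>\<sigma>\<close> for Empty maps a stage and the sequence of all moves before that stage to a move.
\<close>

definition bm_follows :: "('k \<Rightarrow> ('k \<Rightarrow> 'a) \<Rightarrow> 'a) \<Rightarrow> 'k::wellorder \<Rightarrow> ('k \<Rightarrow> 'a) \<Rightarrow> bool" where
  "bm_follows \<sigma> \<alpha> p \<longleftrightarrow> (\<forall>\<beta><\<alpha>. empty_turn \<beta> \<longrightarrow> p \<beta> = \<sigma> \<beta> (restrict p {..<\<beta>}))"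

text \<open>
  \<open>N\<close> is the winning condition of Nonempty for plays that last for all \<open>\<gamma>\<close> stages. A play that
  stops earlier does so because Nonempty has no valid move at a limit stage, so it is won by
  Empty and puts no constraint on \<open>\<sigma>\<close>. Empty herself must always be able to move.
\<close>

definition bm_winning_strategy ::
  "'a set \<Rightarrow> 'a rel \<Rightarrow> 'k::wellorder \<Rightarrow> (('k \<Rightarrow> 'a) \<Rightarrow> bool) \<Rightarrow> ('k \<Rightarrow> ('k \<Rightarrow> 'a) \<Rightarrow> 'a) \<Rightarrow> bool" where
  "bm_winning_strategy Q r \<gamma> N \<sigma> \<longleftrightarrow>
     (\<forall>\<alpha><\<gamma>. \<forall>p. empty_turn \<alpha> \<and> bm_position Q r \<alpha> p \<and> bm_follows \<sigma> \<alpha> p \<longrightarrow>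
        bm_valid_move Q r \<alpha> p (\<sigma> \<alpha> (restrict p {..<\<alpha>}))) \<and>
     (\<forall>p. bm_position Q r \<gamma> p \<and> bm_follows \<sigma> \<gamma> p \<longrightarrow> \<not> N p)"

definition empty_wins_ideal_game :: "'k set set \<Rightarrow> 'k::wellorder \<Rightarrow> bool" where
  "empty_wins_ideal_game I \<gamma> \<longleftrightarrow>
     (\<exists>\<sigma>. bm_winning_strategy (positive_sets I) (relation_of (\<subseteq>) (positive_sets I)) \<gamma>
        (\<lambda>p. (\<Inter>\<alpha>\<in>{..<\<gamma>}. p \<alpha>) \<noteq> {}) \<sigma>)"

definition empty_wins_poset_game :: "'q set \<Rightarrow> 'q rel \<Rightarrow> 'k::wellorder \<Rightarrow> bool" where
  "empty_wins_poset_game Q r \<gamma> \<longleftrightarrow>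
     (\<exists>\<sigma>. bm_winning_strategy Q r \<gamma> (\<lambda>p. \<exists>q\<in>Q. \<forall>\<alpha><\<gamma>. (q, p \<alpha>) \<in> r) \<sigma>)"


section \<open>Cut and choose games\<close>

text \<open>
  In round \<open>\<beta>\<close>, Cut plays an element \<open>W \<beta>\<close> of \<open>P\<close>, the collection of admissible partitions, and
  Choose answers with some \<open>x \<beta> \<in> W \<beta>\<close>. A strategy \<open>\<tau>\<close> for Cut maps a round and the sequences of
  all earlier moves of both players to a move.
\<close>

definition cc_position :: "'a set set \<Rightarrow> 'k::wellorder \<Rightarrow> ('k \<Rightarrow> 'a set) \<Rightarrow> ('k \<Rightarrow> 'a) \<Rightarrow> bool" where
  "cc_position P \<alpha> W x \<longleftrightarrow> (\<forall>\<beta><\<alpha>. W \<beta> \<in> P \<and> x \<beta> \<in> W \<beta>)"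

definition cc_follows ::
  "('k \<Rightarrow> ('k \<Rightarrow> 'a set) \<Rightarrow> ('k \<Rightarrow> 'a) \<Rightarrow> 'a set) \<Rightarrow> 'k::wellorder \<Rightarrow> ('k \<Rightarrow> 'a set) \<Rightarrow> ('k \<Rightarrow> 'a) \<Rightarrow> bool"
  where
  "cc_follows \<tau> \<alpha> W x \<longleftrightarrow> (\<forall>\<beta><\<alpha>. W \<beta> = \<tau> \<beta> (restrict W {..<\<beta>}) (restrict x {..<\<beta>}))"

text \<open>\<open>C\<close> is the winning condition of Choose, in terms of the sequence of choices.\<close>

definition cc_winning_strategy ::
  "'a set set \<Rightarrow> 'k::wellorder \<Rightarrow> (('k \<Rightarrow> 'a) \<Rightarrow> bool) \<Rightarrow>
   ('k \<Rightarrow> ('k \<Rightarrow> 'a set) \<Rightarrow> ('k \<Rightarrow> 'a) \<Rightarrow> 'a set) \<Rightarrow> bool"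
  where
  "cc_winning_strategy P \<gamma> C \<tau> \<longleftrightarrow>
     (\<forall>\<alpha><\<gamma>. \<forall>W x. cc_position P \<alpha> W x \<and> cc_follows \<tau> \<alpha> W x \<longrightarrow>
        \<tau> \<alpha> (restrict W {..<\<alpha>}) (restrict x {..<\<alpha>}) \<in> P) \<and>
     (\<forall>W x. cc_position P \<gamma> W x \<and> cc_follows \<tau> \<gamma> W x \<longrightarrow> \<not> C x)"

text \<open>
  The choices up to stage \<open>\<delta>\<close> include the one made at \<open>\<delta>\<close>. As \<open>\<gamma>\<close> is a limit ordinal and supersets
  of positive sets are positive, excluding it would give the same winning condition.
\<close>

definition cut_wins_ideal_game :: "'k set \<Rightarrow> 'k set set \<Rightarrow> 'k::wellorder \<Rightarrow> bool" where
  "cut_wins_ideal_game X I \<gamma> \<longleftrightarrow>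
     (\<exists>\<tau>. cc_winning_strategy {W. ideal_partition I X W} \<gamma>
        (\<lambda>x. (\<forall>\<delta><\<gamma>. (\<Inter>\<alpha>\<in>{..\<delta>}. x \<alpha>) \<in> positive_sets I) \<and> (\<Inter>\<alpha>\<in>{..<\<gamma>}. x \<alpha>) \<noteq> {}) \<tau>)"

definition cut_wins_poset_game :: "'q \<Rightarrow> 'q set \<Rightarrow> 'q rel \<Rightarrow> 'k::wellorder \<Rightarrow> bool" where
  "cut_wins_poset_game X Q r \<gamma> \<longleftrightarrow>
     (\<exists>\<tau>. cc_winning_strategy {W. max_antichain_below Q r X W} \<gamma>
        (\<lambda>x. \<exists>q\<in>Q. \<forall>\<alpha><\<gamma>. (q, x \<alpha>) \<in> r) \<tau>)"

end

theory Submission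
  imports Defs
begin

text \<open>
  The positive sets of an ideal, ordered by inclusion, form a poset in which the maximal
  antichains below \<open>X\<close> are the ideal partitions of \<open>X\<close>. So both equivalences are about the
  same pair of games on a poset and differ only in who wins the plays of full length; they are
  instances of \<open>Empty_wins_iff_Cut_wins\<close>, which asks of the two winning conditions only that they
  agree on interleaved sequences of moves and choices.

  Suppose that Empty has a winning strategy \<open>\<sigma>\<close> with first move \<open>X\<close>
  (\<open>Cut_wins_if_Empty_wins\<close>). At a stage of Empty, Cut plays a partition built around a maximal
  antichain of possible answers of \<open>\<sigma>\<close> to Nonempty's preceding move. If Choose picks an answer, then
  some move of Nonempty leads to it, and the choices thus encode a Banach-Mazur play that follows
  \<open>\<sigma>\<close>. If Choose leaves the answers, then no lower bound of the choices remains: it would be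
  a legal move of Nonempty, and the answer of \<open>\<sigma>\<close> to it would lie below the choice, which
  the maximality of the antichain forbids. In either case Choose loses.

  Conversely, suppose that Cut has a winning strategy below \<open>X\<close> (\<open>Empty_wins_if_Cut_wins\<close>). Empty
  starts below \<open>X\<close> and afterwards always plays below a member of each partition that Cut has
  played, which is possible since a maximal antichain contains an element compatible with
  the last move of Nonempty. The members that are met form a run of the cut and choose game. Cut
  wins that run, so Nonempty does not win the play.

  Only every other stage of the Banach-Mazur game belongs to Empty, while Cut moves in each round.
  Instead of renumbering the stages, stage \<open>\<alpha>\<close> of one game is matched with round \<open>\<alpha>\<close> of the other:
  in the first construction only the rounds after a move of Nonempty carry
  information, and in the second Empty deals with two rounds in one move.
\<close>

section \<open>Recursion and successors on a well-ordered type\<close>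

definition course_rec :: "('k::wellorder \<Rightarrow> ('k \<Rightarrow> 'a) \<Rightarrow> 'a) \<Rightarrow> 'k \<Rightarrow> 'a" where
  "course_rec F = wfrec {(\<xi>, \<alpha>). \<xi> < \<alpha>} (\<lambda>f \<alpha>. F \<alpha> f)"

lemma course_rec:
  fixes F :: "'k::wellorder \<Rightarrow> ('k \<Rightarrow> 'a) \<Rightarrow> 'a"
  shows "course_rec F \<alpha> = F \<alpha> (restrict (course_rec F) {..<\<alpha>})"
proof -
  have "cut f {(\<xi>, \<alpha>). \<xi> < \<alpha>} \<alpha> = restrict f {..<\<alpha>}"
    for f :: "'k \<Rightarrow> 'a" and \<alpha>
    by (auto simp: cut_def restrict_def fun_eq_iff)
  then show ?thesis
    unfolding course_rec_def using wfrec[OF wf, of "\<lambda>f \<alpha>. F \<alpha> f" \<alpha>] by simp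
qed

lemma restrict_lessThan_eq_iff:
  "restrict p {..<\<alpha>} = restrict q {..<\<alpha>} \<longleftrightarrow> (\<forall>\<xi><\<alpha>. p \<xi> = q \<xi>)" for \<alpha> :: "'k::wellorder"
  by (auto simp: fun_eq_iff restrict_def)

definition next_stage :: "'k::wellorder \<Rightarrow> 'k" where
  "next_stage \<alpha> = (LEAST \<xi>. \<alpha> < \<xi>)"

lemma successor_next_stage:
  assumes "\<alpha> < \<beta>"
  shows "successor_of \<alpha> (next_stage \<alpha>)" "next_stage \<alpha> \<le> \<beta>"
  using assms LeastI[of "\<lambda>\<xi>. \<alpha> < \<xi>"] Least_le[of "\<lambda>\<xi>. \<alpha> < \<xi>"]
  unfolding successor_of_def next_stage_def by auto

lemma next_stage_eq: "successor_of \<alpha> \<beta> \<Longrightarrow> next_stage \<alpha> = \<beta>"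
  unfolding successor_of_def next_stage_def by (rule Least_equality) auto

lemma less_successor_iff: "successor_of \<alpha> \<beta> \<Longrightarrow> \<xi> < \<beta> \<longleftrightarrow> \<xi> < \<alpha> \<or> \<xi> = \<alpha>"
  unfolding successor_of_def by (meson leD less_trans linorder_neqE)

lemma next_stage_less_limit:
  assumes "limit_ordinal \<gamma>" "\<alpha> < \<gamma>"
  shows "next_stage \<alpha> < \<gamma>"
proof -
  obtain \<xi> where "\<alpha> < \<xi>" "\<xi> < \<gamma>" using assms unfolding limit_ordinal_def by blast
  then show ?thesis using successor_next_stage(2)[of \<alpha> \<xi>] by simp
qed

lemma empty_turn_cases:
  assumes "empty_turn \<alpha>"
  obtains "\<And>\<beta>. \<alpha> \<le> \<beta>" | \<beta> where "nonempty_turn \<beta>" "successor_of \<beta> \<alpha>"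
  using assms by (cases rule: empty_turn.cases) auto


section \<open>Maximal antichains\<close>

text \<open>
  Antichains are needed both within the set of conditions below \<open>X\<close> and within the smaller, not
  necessarily downward closed sets of answers of Empty, so the ambient set \<open>D\<close> is arbitrary.
\<close>

definition antichain_in :: "'q set \<Rightarrow> 'q rel \<Rightarrow> 'q set \<Rightarrow> 'q set \<Rightarrow> bool" where
  "antichain_in Q r D A \<longleftrightarrow>
     A \<subseteq> D \<and> (\<forall>p\<in>A. \<forall>q\<in>A. p \<noteq> q \<longrightarrow> \<not> compatible Q r p q)"

lemma antichain_below_eq: "antichain_below Q r X = antichain_in Q r {p \<in> Q. (p, X) \<in> r}"
  by (simp add: antichain_below_def antichain_in_def fun_eq_iff)

text \<open>
  Zorn's lemma applies because two members of the union of a chain already lie in one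
  member of the chain.
\<close>

lemma antichain_in_extends:
  assumes "antichain_in Q r D A"
  shows "\<exists>W. antichain_in Q r D W \<and> A \<subseteq> W \<and> (\<forall>W'. antichain_in Q r D W' \<and> W \<subseteq> W' \<longrightarrow> W' = W)"
proof -
  let ?F = "{W. antichain_in Q r D W \<and> A \<subseteq> W}"
  have "\<exists>W\<in>?F. \<forall>W'\<in>?F. W \<subseteq> W' \<longrightarrow> W' = W"
  proof (rule subset_Zorn_nonempty)
    show "?F \<noteq> {}" using assms by auto
  next
    fix C assume "C \<noteq> {}" and ch: "subset.chain ?F C"
    then have C: "\<And>U. U \<in> C \<Longrightarrow> antichain_in Q r D U \<and> A \<subseteq> U"
      and lin: "\<And>U V. U \<in> C \<Longrightarrow> V \<in> C \<Longrightarrow> U \<subseteq> V \<or> V \<subseteq> U"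
      unfolding subset_chain_def by blast+
    have "\<not> compatible Q r p q" if pq: "p \<in> \<Union>C" "q \<in> \<Union>C" "p \<noteq> q" for p q
    proof -
      from pq obtain U V where UV: "U \<in> C" "p \<in> U" "V \<in> C" "q \<in> V" by auto
      from lin[OF UV(1,3)] obtain Z where "Z \<in> C" "p \<in> Z" "q \<in> Z" using UV by auto
      then show ?thesis using C[of Z] pq(3) unfolding antichain_in_def by auto
    qed
    moreover have "\<Union>C \<subseteq> D"
      using C unfolding antichain_in_def by (intro Union_least) simp
    moreover have "A \<subseteq> \<Union>C" using C \<open>C \<noteq> {}\<close> by auto
    ultimately show "\<Union>C \<in> ?F" unfolding antichain_in_def by simp
  qed
  then obtain W where W: "antichain_in Q r D W" "A \<subseteq> W"
    and max: "\<And>W'. antichain_in Q r D W' \<Longrightarrow> A \<subseteq> W' \<Longrightarrow> W \<subseteq> W' \<Longrightarrow> W' = W"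
    by auto
  then show ?thesis by (meson order_trans)
qed

lemma maximal_antichain_in_meets:
  assumes "antichain_in Q r D W" "\<forall>W'. antichain_in Q r D W' \<and> W \<subseteq> W' \<longrightarrow> W' = W"
    and "d \<in> D" "d \<in> Q" "(d, d) \<in> r"
  shows "\<exists>w\<in>W. compatible Q r d w"
proof (rule ccontr)
  assume inc: "\<not> ?thesis"
  have sym: "compatible Q r p q \<longleftrightarrow> compatible Q r q p" for p q
    unfolding compatible_def by blast
  have "antichain_in Q r D (insert d W)"
    using assms(1,3) inc sym unfolding antichain_in_def by blast
  then have "d \<in> W" using assms(2) by blast
  moreover have "compatible Q r d d" using assms(4,5) unfolding compatible_def by blast
  ultimately show False using inc by blast
qed

text \<open>
  The witness is the partition that Cut plays when \<open>D\<close> is the set of possible answers of Empty: an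
  antichain that is maximal within \<open>D\<close>, extended to one that is maximal below \<open>X\<close>. A choice
  that is not in \<open>D\<close> is incompatible with the maximal antichain of \<open>D\<close>, so no answer of Empty
  lies below it.
\<close>

lemma max_antichain_below_catches:
  assumes "preorder_on Q r"
  shows "\<exists>W. max_antichain_below Q r X W \<and> (\<forall>w\<in>W. \<forall>d\<in>D. (d, w) \<in> r \<longrightarrow> w \<in> D)"
proof -
  have rQ: "r \<subseteq> Q \<times> Q" and refl: "\<And>q. q \<in> Q \<Longrightarrow> (q, q) \<in> r" and tr: "trans r"
    using assms unfolding preorder_on_def refl_on_def by auto
  define B where "B = {p \<in> Q. (p, X) \<in> r}"
  have "antichain_in Q r (D \<inter> B) {}" by (simp add: antichain_in_def)
  from antichain_in_extends[OF this] obtain A where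
    A: "antichain_in Q r (D \<inter> B) A" "\<forall>W'. antichain_in Q r (D \<inter> B) W' \<and> A \<subseteq> W' \<longrightarrow> W' = A"
    by blast
  then have "antichain_in Q r B A" unfolding antichain_in_def by blast
  from antichain_in_extends[OF this] obtain W where
    W: "antichain_in Q r B W" "A \<subseteq> W" "\<forall>W'. antichain_in Q r B W' \<and> W \<subseteq> W' \<longrightarrow> W' = W"
    by blast
  have "w \<in> D" if w: "w \<in> W" "d \<in> D" "(d, w) \<in> r" for w d
  proof -
    have d: "d \<in> D \<inter> B" "d \<in> Q"
      using w(1,2) W(1) rQ w(3) transD[OF tr w(3), of X] unfolding antichain_in_def B_def by blast+
    obtain a where a: "a \<in> A" "compatible Q r d a"
      using maximal_antichain_in_meets[OF A d refl[OF d(2)]] by blast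
    then have "compatible Q r w a"
      using transD[OF tr _ w(3)] unfolding compatible_def by blast
    then have "w = a" using W w(1) a(1) unfolding antichain_in_def by blast
    then show ?thesis using a A(1) unfolding antichain_in_def by blast
  qed
  moreover have "max_antichain_below Q r X W"
    using W(1,3) unfolding max_antichain_below_def antichain_below_eq B_def by simp
  ultimately show ?thesis by blast
qed

text \<open>
  This is what lets Empty follow Cut: whatever was played last, Empty can move below it and
  into the new partition.
\<close>

lemma max_antichain_below_refines:
  assumes "preorder_on Q r" "max_antichain_below Q r X W" "(b, X) \<in> r"
  shows "\<exists>w\<in>W. \<exists>s. (s, b) \<in> r \<and> (s, w) \<in> r"
proof -
  have "b \<in> Q" "(b, b) \<in> r"
    using assms unfolding preorder_on_def refl_on_def by auto
  then show ?thesis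
    using maximal_antichain_in_meets[of Q r "{p \<in> Q. (p, X) \<in> r}" W b] assms(2,3)
    unfolding max_antichain_below_def antichain_below_eq compatible_def by blast
qed

lemma antichain_below_unique:
  assumes "preorder_on Q r" "max_antichain_below Q r X W" "v \<in> W" "w \<in> W" "(s, v) \<in> r" "(s, w) \<in> r"
  shows "v = w"
  using assms unfolding max_antichain_below_def antichain_below_def compatible_def preorder_on_def
  by blast


section \<open>Strategies of Cut that only look at the choices\<close>

definition cut_wins_by_choices ::
  "'a set set \<Rightarrow> 'k::wellorder \<Rightarrow> (('k \<Rightarrow> 'a) \<Rightarrow> bool) \<Rightarrow> ('k \<Rightarrow> ('k \<Rightarrow> 'a) \<Rightarrow> 'a set) \<Rightarrow> bool"
  where
  "cut_wins_by_choices P \<gamma> C T \<longleftrightarrow>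
     (\<forall>\<alpha> x y. (\<forall>\<xi><\<alpha>. x \<xi> = y \<xi>) \<longrightarrow> T \<alpha> x = T \<alpha> y) \<and>
     (\<forall>\<alpha><\<gamma>. \<forall>x. (\<forall>\<beta><\<alpha>. x \<beta> \<in> T \<beta> x) \<longrightarrow> T \<alpha> x \<in> P) \<and>
     (\<forall>x. (\<forall>\<beta><\<gamma>. x \<beta> \<in> T \<beta> x) \<longrightarrow> \<not> C x)"

text \<open>
  The earlier moves of Cut in a play that follows a strategy can be recomputed from the choices by
  recursion on the round. Hence a strategy need not be shown them, and in a translation between
  the games only one sequence, the choices, has to be carried along.
\<close>

lemma cc_winning_strategy_iff_by_choices:
  "(\<exists>\<tau>. cc_winning_strategy P \<gamma> C \<tau>) \<longleftrightarrow> (\<exists>T. cut_wins_by_choices P \<gamma> C T)"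
proof
  assume "\<exists>\<tau>. cc_winning_strategy P \<gamma> C \<tau>"
  then obtain \<tau> where \<tau>: "cc_winning_strategy P \<gamma> C \<tau>" ..
  define T where "T \<alpha> x = course_rec (\<lambda>\<alpha> W. \<tau> \<alpha> W (restrict x {..<\<alpha>})) \<alpha>" for \<alpha> x
  have T: "T \<alpha> x = \<tau> \<alpha> (restrict (\<lambda>\<beta>. T \<beta> x) {..<\<alpha>}) (restrict x {..<\<alpha>})" for \<alpha> x
    unfolding T_def by (subst course_rec) simp
  have local: "T \<alpha> x = T \<alpha> y" if "\<forall>\<xi><\<alpha>. x \<xi> = y \<xi>" for \<alpha> x y
    using that
  proof (induction \<alpha> rule: less_induct)
    case (less \<alpha>)
    then have "\<forall>\<xi><\<alpha>. T \<xi> x = T \<xi> y" by auto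
    then have "restrict (\<lambda>\<beta>. T \<beta> x) {..<\<alpha>} = restrict (\<lambda>\<beta>. T \<beta> y) {..<\<alpha>}"
      "restrict x {..<\<alpha>} = restrict y {..<\<alpha>}"
      using less.prems by (auto simp: restrict_lessThan_eq_iff)
    then show ?case by (simp add: T[of \<alpha> x] T[of \<alpha> y])
  qed
  have follows: "cc_follows \<tau> \<alpha> (\<lambda>\<beta>. T \<beta> x) x" for \<alpha> x
    unfolding cc_follows_def by (intro allI impI T)
  have legal: "T \<alpha> x \<in> P" if "\<alpha> < \<gamma>" "\<forall>\<beta><\<alpha>. x \<beta> \<in> T \<beta> x" for \<alpha> x
    using that
  proof (induction \<alpha> rule: less_induct)
    case (less \<alpha>)
    then have "cc_position P \<alpha> (\<lambda>\<beta>. T \<beta> x) x" unfolding cc_position_def by auto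
    then have "\<tau> \<alpha> (restrict (\<lambda>\<beta>. T \<beta> x) {..<\<alpha>}) (restrict x {..<\<alpha>}) \<in> P"
      using \<tau> follows[of \<alpha> x] less.prems(1) unfolding cc_winning_strategy_def by blast
    then show ?case by (subst T)
  qed
  have "\<not> C x" if "\<forall>\<beta><\<gamma>. x \<beta> \<in> T \<beta> x" for x
  proof -
    have "cc_position P \<gamma> (\<lambda>\<beta>. T \<beta> x) x" using that legal unfolding cc_position_def by auto
    then show ?thesis using \<tau> follows unfolding cc_winning_strategy_def by blast
  qed
  then have "cut_wins_by_choices P \<gamma> C T"
    unfolding cut_wins_by_choices_def using local legal by blast
  then show "\<exists>T. cut_wins_by_choices P \<gamma> C T" by (rule exI[of _ T])
next
  assume "\<exists>T. cut_wins_by_choices P \<gamma> C T"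
  then obtain T where local: "\<And>\<alpha> x y. (\<forall>\<xi><\<alpha>. x \<xi> = y \<xi>) \<Longrightarrow> T \<alpha> x = T \<alpha> y"
    and legal: "\<And>\<alpha> x. \<alpha> < \<gamma> \<Longrightarrow> (\<forall>\<beta><\<alpha>. x \<beta> \<in> T \<beta> x) \<Longrightarrow> T \<alpha> x \<in> P"
    and win: "\<And>x. (\<forall>\<beta><\<gamma>. x \<beta> \<in> T \<beta> x) \<Longrightarrow> \<not> C x"
    unfolding cut_wins_by_choices_def by blast
  have restr: "T \<alpha> (restrict x {..<\<alpha>}) = T \<alpha> x" for \<alpha> x
    by (rule local) auto
  have "cc_winning_strategy P \<gamma> C (\<lambda>\<alpha> W x. T \<alpha> x)"
    unfolding cc_winning_strategy_def cc_position_def cc_follows_def restr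
  proof (intro conjI allI impI)
    show "T \<alpha> x \<in> P"
      if "\<alpha> < \<gamma>" "(\<forall>\<beta><\<alpha>. W \<beta> \<in> P \<and> x \<beta> \<in> W \<beta>) \<and> (\<forall>\<beta><\<alpha>. W \<beta> = T \<beta> x)" for \<alpha> W x
      using that by (intro legal) auto
    show "\<not> C x"
      if "(\<forall>\<beta><\<gamma>. W \<beta> \<in> P \<and> x \<beta> \<in> W \<beta>) \<and> (\<forall>\<beta><\<gamma>. W \<beta> = T \<beta> x)" for W x
      using that by (intro win) auto
  qed
  then show "\<exists>\<tau>. cc_winning_strategy P \<gamma> C \<tau>" by (rule exI[of _ "\<lambda>\<alpha> W x. T \<alpha> x"])
qed


section \<open>From a strategy for Empty to a strategy for Cut\<close>

text \<open>
  The Banach-Mazur play that a sequence \<open>x\<close> of choices stands for. Empty moves according to \<open>\<sigma>\<close>, and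
  Nonempty moves so that the answer of \<open>\<sigma>\<close> one stage later is the choice made there. The move of
  Nonempty at \<open>\<beta>\<close> thus depends on the choice in the round after \<open>\<beta>\<close>.
\<close>

definition replay ::
  "'a set \<Rightarrow> 'a rel \<Rightarrow> ('k::wellorder \<Rightarrow> ('k \<Rightarrow> 'a) \<Rightarrow> 'a) \<Rightarrow> ('k \<Rightarrow> 'a) \<Rightarrow> 'k \<Rightarrow> 'a"
  where
  "replay Q r \<sigma> x = course_rec (\<lambda>\<beta> p.
     if empty_turn \<beta> then \<sigma> \<beta> p
     else SOME q. bm_valid_move Q r \<beta> p q \<and>
       \<sigma> (next_stage \<beta>) (restrict (p(\<beta> := q)) {..<next_stage \<beta>}) = x (next_stage \<beta>))"

lemma bm_valid_move_cong:
  assumes "\<And>\<xi>. \<xi> < \<alpha> \<Longrightarrow> p \<xi> = p' \<xi>"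
  shows "bm_valid_move Q r \<alpha> p = bm_valid_move Q r \<alpha> p'"
  unfolding bm_valid_move_def fun_eq_iff using assms by simp

lemma restrict_update_cong:
  assumes "successor_of \<beta> \<alpha>" "\<And>\<xi>. \<xi> < \<beta> \<Longrightarrow> p \<xi> = p' \<xi>"
  shows "restrict (p(\<beta> := q)) {..<\<alpha>} = restrict (p'(\<beta> := q)) {..<\<alpha>}"
  unfolding restrict_lessThan_eq_iff
proof (intro allI impI)
  fix \<xi> assume "\<xi> < \<alpha>"
  then have "\<xi> < \<beta> \<or> \<xi> = \<beta>" by (simp only: less_successor_iff[OF assms(1)])
  then show "(p(\<beta> := q)) \<xi> = (p'(\<beta> := q)) \<xi>" using assms(2) by auto
qed

lemma replay_empty:
  "empty_turn \<beta> \<Longrightarrow> replay Q r \<sigma> x \<beta> = \<sigma> \<beta> (restrict (replay Q r \<sigma> x) {..<\<beta>})"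
  unfolding replay_def by (subst course_rec) simp

lemma replay_nonempty:
  fixes \<beta> :: "'k::wellorder" and x :: "'k \<Rightarrow> 'a"
  assumes "nonempty_turn \<beta>" "successor_of \<beta> \<alpha>"
  shows "replay Q r \<sigma> x \<beta> = (SOME q. bm_valid_move Q r \<beta> (replay Q r \<sigma> x) q \<and>
           \<sigma> \<alpha> (restrict ((replay Q r \<sigma> x)(\<beta> := q)) {..<\<alpha>}) = x \<alpha>)"
proof -
  have "restrict ((restrict p {..<\<beta>})(\<beta> := q)) {..<\<alpha>} = restrict (p(\<beta> := q)) {..<\<alpha>}"
    for p :: "'k \<Rightarrow> 'a" and q
    by (rule restrict_update_cong[OF assms(2)]) simp
  moreover have "bm_valid_move Q r \<beta> (restrict p {..<\<beta>}) = bm_valid_move Q r \<beta> p"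
    for p :: "'k \<Rightarrow> 'a"
    by (rule bm_valid_move_cong) simp
  ultimately show ?thesis
    using assms(1) unfolding replay_def
    by (subst course_rec) (simp add: nonempty_turn_iff next_stage_eq[OF assms(2)])
qed

text \<open>
  The look-ahead by one stage does no harm: a stage \<open>\<xi>\<close> of Nonempty before \<open>\<beta>\<close> looks at the choice in
  its successor, which is still at most \<open>\<beta>\<close>. This makes the answers of Empty to a move at \<open>\<beta>\<close>
  known to Cut in the round after \<open>\<beta>\<close>.
\<close>

lemma replay_cong:
  assumes "nonempty_turn \<beta>" "\<forall>\<xi>\<le>\<beta>. x \<xi> = y \<xi>"
  shows "\<xi> < \<beta> \<Longrightarrow> replay Q r \<sigma> x \<xi> = replay Q r \<sigma> y \<xi>"
proof (induction \<xi> rule: less_induct)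
  case (less \<xi>)
  then have IH: "\<And>\<eta>. \<eta> < \<xi> \<Longrightarrow> replay Q r \<sigma> x \<eta> = replay Q r \<sigma> y \<eta>" by auto
  show ?case
  proof (cases "empty_turn \<xi>")
    case True
    have "restrict (replay Q r \<sigma> x) {..<\<xi>} = restrict (replay Q r \<sigma> y) {..<\<xi>}"
      using IH by (simp add: restrict_lessThan_eq_iff)
    then show ?thesis by (simp add: replay_empty[OF True])
  next
    case False
    then have non: "nonempty_turn \<xi>" by (simp add: nonempty_turn_iff)
    note suc = successor_next_stage[OF less.prems]
    have "restrict ((replay Q r \<sigma> x)(\<xi> := q)) {..<next_stage \<xi>}
      = restrict ((replay Q r \<sigma> y)(\<xi> := q)) {..<next_stage \<xi>}" for q
      using suc(1) IH by (rule restrict_update_cong)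
    moreover have "bm_valid_move Q r \<xi> (replay Q r \<sigma> x) = bm_valid_move Q r \<xi> (replay Q r \<sigma> y)"
      using IH by (rule bm_valid_move_cong)
    ultimately show ?thesis
      using assms(2) suc(2) by (simp add: replay_nonempty[OF non suc(1)])
  qed
qed

text \<open>
  There is at most one predecessor \<open>\<beta>\<close>. At limits, at the first stage and at the stages of Nonempty
  the set is empty, and Cut then plays an arbitrary partition.
\<close>

definition possible_answers ::
  "'a set \<Rightarrow> 'a rel \<Rightarrow> ('k::wellorder \<Rightarrow> ('k \<Rightarrow> 'a) \<Rightarrow> 'a) \<Rightarrow> 'k \<Rightarrow> ('k \<Rightarrow> 'a) \<Rightarrow> 'a set"
  where
  "possible_answers Q r \<sigma> \<alpha> x =
     {\<sigma> \<alpha> (restrict ((replay Q r \<sigma> x)(\<beta> := q)) {..<\<alpha>}) | \<beta> q.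
        nonempty_turn \<beta> \<and> successor_of \<beta> \<alpha> \<and> bm_valid_move Q r \<beta> (replay Q r \<sigma> x) q}"

lemma possible_answers_cong:
  assumes "\<forall>\<xi><\<alpha>. x \<xi> = y \<xi>"
  shows "possible_answers Q r \<sigma> \<alpha> x = possible_answers Q r \<sigma> \<alpha> y"
proof -
  have "restrict ((replay Q r \<sigma> x)(\<beta> := q)) {..<\<alpha>} = restrict ((replay Q r \<sigma> y)(\<beta> := q)) {..<\<alpha>}
      \<and> bm_valid_move Q r \<beta> (replay Q r \<sigma> x) q = bm_valid_move Q r \<beta> (replay Q r \<sigma> y) q"
    if "nonempty_turn \<beta>" "successor_of \<beta> \<alpha>" for \<beta> q
  proof -
    have "\<forall>\<xi>\<le>\<beta>. x \<xi> = y \<xi>" using assms less_successor_iff[OF that(2)] by (auto simp: le_less)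
    then have eq: "\<And>\<xi>. \<xi> < \<beta> \<Longrightarrow> replay Q r \<sigma> x \<xi> = replay Q r \<sigma> y \<xi>"
      using replay_cong[OF that(1)] by blast
    show ?thesis
    proof
      show "restrict ((replay Q r \<sigma> x)(\<beta> := q)) {..<\<alpha>} = restrict ((replay Q r \<sigma> y)(\<beta> := q)) {..<\<alpha>}"
        using that(2) eq by (rule restrict_update_cong)
      have "bm_valid_move Q r \<beta> (replay Q r \<sigma> x) = bm_valid_move Q r \<beta> (replay Q r \<sigma> y)"
        using eq by (rule bm_valid_move_cong)
      then show "bm_valid_move Q r \<beta> (replay Q r \<sigma> x) q = bm_valid_move Q r \<beta> (replay Q r \<sigma> y) q"
        by simp
    qed
  qed
  then show ?thesis
    unfolding possible_answers_def by (intro Collect_cong iff_exI) metis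
qed

text \<open>
  Suppose that Choose won a run against this strategy of Cut. By induction on the stages of
  Nonempty, the replayed moves are legal and each choice after such a stage is the answer of
  \<open>\<sigma>\<close>. So the choices and the replayed moves are interleaved, and Nonempty would win a play
  against \<open>\<sigma>\<close>. The assumption \<open>bound\<close> supplies a lower bound of the choices so far and
  thereby a legal move of Nonempty, at limits as well.
\<close>

lemma Cut_wins_if_Empty_wins:
  fixes \<gamma> :: "'k::wellorder"
  assumes pre: "preorder_on Q r" and lim: "limit_ordinal \<gamma>"
    and bound: "\<And>x \<delta>. C x \<Longrightarrow> \<delta> < \<gamma> \<Longrightarrow> \<exists>q\<in>Q. \<forall>\<beta>\<le>\<delta>. (q, x \<beta>) \<in> r"
    and CN: "\<And>p x. C x \<Longrightarrow> (\<forall>\<alpha><\<gamma>. \<exists>\<beta><\<gamma>. (x \<beta>, p \<alpha>) \<in> r) \<Longrightarrow> N p"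
    and win: "bm_winning_strategy Q r \<gamma> N \<sigma>"
  shows "\<exists>X\<in>Q. \<exists>T. cut_wins_by_choices {W. max_antichain_below Q r X W} \<gamma> C T"
proof -
  have tr: "\<And>a b c. (a, b) \<in> r \<Longrightarrow> (b, c) \<in> r \<Longrightarrow> (a, c) \<in> r"
    using pre unfolding preorder_on_def by (meson transD)
  define z :: 'k where "z = (LEAST \<xi>. True)"
  have z: "z \<le> \<xi>" for \<xi> unfolding z_def by (simp add: Least_le)
  then have z_empty: "empty_turn z" by (rule empty_turn_nonempty_turn.start)
  have "z < \<gamma>" using lim z unfolding limit_ordinal_def by (meson le_less_trans)
  define X where "X = \<sigma> z (\<lambda>_. undefined)"
  have first: "restrict p {..<z} = (\<lambda>_. undefined)" for p :: "'k \<Rightarrow> 'a"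
    using z by (auto simp: fun_eq_iff leD)
  have Empty_moves: "bm_valid_move Q r \<alpha> p (\<sigma> \<alpha> (restrict p {..<\<alpha>}))"
    if "\<alpha> < \<gamma>" "empty_turn \<alpha>" "bm_position Q r \<alpha> p" "bm_follows \<sigma> \<alpha> p" for \<alpha> p
    using win that unfolding bm_winning_strategy_def by blast
  have X: "X \<in> Q"
    using Empty_moves[OF \<open>z < \<gamma>\<close> z_empty, of undefined] z
    unfolding X_def first bm_position_def bm_follows_def bm_valid_move_def by (simp add: leD)
  define T where "T \<alpha> x = (SOME W. max_antichain_below Q r X W \<and>
      (\<forall>w\<in>W. \<forall>d\<in>possible_answers Q r \<sigma> \<alpha> x. (d, w) \<in> r \<longrightarrow> w \<in> possible_answers Q r \<sigma> \<alpha> x))"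
    for \<alpha> x
  have T_max: "max_antichain_below Q r X (T \<alpha> x)"
    and T_catches: "w \<in> T \<alpha> x \<Longrightarrow> d \<in> possible_answers Q r \<sigma> \<alpha> x \<Longrightarrow> (d, w) \<in> r
      \<Longrightarrow> w \<in> possible_answers Q r \<sigma> \<alpha> x" for \<alpha> x w d
    using someI_ex[OF max_antichain_below_catches[OF pre, of X "possible_answers Q r \<sigma> \<alpha> x"]]
    unfolding T_def by blast+
  have lose: "\<not> C x" if choices: "\<forall>\<beta><\<gamma>. x \<beta> \<in> T \<beta> x" for x
  proof
    assume "C x"
    define p where "p = replay Q r \<sigma> x"
    have p_empty: "p \<beta> = \<sigma> \<beta> (restrict p {..<\<beta>})" if "empty_turn \<beta>" for \<beta>
      unfolding p_def using that by (rule replay_empty)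
    then have follows: "bm_follows \<sigma> \<alpha> p" for \<alpha> unfolding bm_follows_def by blast
    \<comment> \<open>Since \<open>\<sigma>\<close> moves legally, only the moves of Nonempty have to be checked.\<close>
    have position: "bm_position Q r \<alpha> p"
      if "\<alpha> \<le> \<gamma>" "\<forall>\<beta><\<alpha>. nonempty_turn \<beta> \<longrightarrow> bm_valid_move Q r \<beta> p (p \<beta>)" for \<alpha>
    proof -
      have "\<beta> < \<alpha> \<Longrightarrow> bm_valid_move Q r \<beta> p (p \<beta>)" for \<beta>
      proof (induction \<beta> rule: less_induct)
        case (less \<beta>)
        show ?case
        proof (cases "empty_turn \<beta>")
          case True
          have "bm_position Q r \<beta> p" using less unfolding bm_position_def by auto
          then have "bm_valid_move Q r \<beta> p (\<sigma> \<beta> (restrict p {..<\<beta>}))"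
            using less.prems that(1) by (intro Empty_moves[OF _ True _ follows]) auto
          then show ?thesis by (simp only: p_empty[OF True, symmetric])
        next
          case False
          then show ?thesis using that(2) less.prems by (simp add: nonempty_turn_iff)
        qed
      qed
      then show ?thesis unfolding bm_position_def by blast
    qed
    have good: "bm_valid_move Q r \<beta> p (p \<beta>) \<and> p (next_stage \<beta>) = x (next_stage \<beta>)"
      if "\<beta> < \<gamma>" "nonempty_turn \<beta>" for \<beta>
      using that
    proof (induction \<beta> rule: less_induct)
      case (less \<beta>)
      define \<alpha> where "\<alpha> = next_stage \<beta>"
      have suc: "successor_of \<beta> \<alpha>" and "\<beta> < \<alpha>" and \<alpha>: "\<alpha> < \<gamma>"
        using successor_next_stage[OF less.prems(1)] next_stage_less_limit[OF lim less.prems(1)]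
        unfolding \<alpha>_def successor_of_def by auto
      have \<alpha>_empty: "empty_turn \<alpha>"
        using less.prems(2) suc by (rule empty_turn_nonempty_turn.after_nonempty)
      have pos: "bm_position Q r \<beta> p"
        using less by (intro position) auto
      obtain q where q: "q \<in> Q" "\<And>\<xi>. \<xi> \<le> \<alpha> \<Longrightarrow> (q, x \<xi>) \<in> r"
        using bound[OF \<open>C x\<close> \<alpha>] by blast
      \<comment> \<open>A bound of the choices is a bound of the replayed moves, hence a legal move.\<close>
      have below_empty: "(q, p \<xi>) \<in> r" if "\<xi> < \<beta>" "empty_turn \<xi>" for \<xi>
        using that(2)
      proof (cases rule: empty_turn_cases)
        case 1
        then have "\<xi> = z" using z by (simp add: antisym)
        then have "p \<xi> = X" using p_empty[OF z_empty] first X_def by simp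
        moreover have "(x z, X) \<in> r"
          using choices \<open>z < \<gamma>\<close> T_max unfolding max_antichain_below_def antichain_below_def by blast
        ultimately show ?thesis using q(2)[OF z] tr by simp
      next
        case (2 \<eta>)
        have "\<eta> < \<xi>" using 2 unfolding successor_of_def by simp
        then have "p \<xi> = x \<xi>"
          using less.IH[of \<eta>] 2 that(1) less.prems(1) next_stage_eq[of \<eta> \<xi>] by auto
        then show ?thesis using q(2)[of \<xi>] that(1) \<open>\<beta> < \<alpha>\<close> by simp
      qed
      have "(q, p \<xi>) \<in> r" if "\<xi> < \<beta>" for \<xi>
      proof (cases "empty_turn \<xi>")
        case False
        then have non: "nonempty_turn \<xi>" by (simp add: nonempty_turn_iff)
        note s = successor_next_stage[OF that]
        have e: "empty_turn (next_stage \<xi>)"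
          using non s(1) by (rule empty_turn_nonempty_turn.after_nonempty)
        then have l: "next_stage \<xi> < \<beta>"
          using s(2) less.prems(2) by (auto simp: le_less nonempty_turn_iff)
        then have "(p (next_stage \<xi>), p \<xi>) \<in> r"
          using pos s(1) unfolding bm_position_def bm_valid_move_def successor_of_def by blast
        then show ?thesis using below_empty[OF l e] tr by blast
      qed (use below_empty that in blast)
      then have valid: "bm_valid_move Q r \<beta> p q" using q(1) unfolding bm_valid_move_def by blast
      \<comment> \<open>The answer to \<open>q\<close> lies below the choice at \<open>\<alpha>\<close>, so that choice is an answer as well.\<close>
      define d where "d = \<sigma> \<alpha> (restrict (p(\<beta> := q)) {..<\<alpha>})"
      have "bm_position Q r \<alpha> (p(\<beta> := q))"
        using pos valid less_successor_iff[OF suc]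
        unfolding bm_position_def bm_valid_move_def by auto
      moreover have "bm_follows \<sigma> \<alpha> (p(\<beta> := q))"
        unfolding bm_follows_def
      proof (intro allI impI)
        fix \<xi> assume "\<xi> < \<alpha>" "empty_turn \<xi>"
        then have "\<xi> < \<beta>" using less.prems(2) less_successor_iff[OF suc] by (auto simp: nonempty_turn_iff)
        then have "restrict (p(\<beta> := q)) {..<\<xi>} = restrict p {..<\<xi>}"
          using \<open>\<xi> < \<beta>\<close> by (auto simp: restrict_lessThan_eq_iff)
        then show "(p(\<beta> := q)) \<xi> = \<sigma> \<xi> (restrict (p(\<beta> := q)) {..<\<xi>})"
          using \<open>\<xi> < \<beta>\<close> p_empty[OF \<open>empty_turn \<xi>\<close>] by (metis fun_upd_other less_irrefl)
      qed
      ultimately have "bm_valid_move Q r \<alpha> (p(\<beta> := q)) d"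
        unfolding d_def by (rule Empty_moves[OF \<alpha> \<alpha>_empty])
      then have "(d, q) \<in> r" using \<open>\<beta> < \<alpha>\<close> unfolding bm_valid_move_def by (metis fun_upd_same)
      then have "(d, x \<alpha>) \<in> r" using q(2)[of \<alpha>] tr by blast
      moreover have "d \<in> possible_answers Q r \<sigma> \<alpha> x"
        using valid suc less.prems(2) unfolding possible_answers_def d_def p_def by blast
      ultimately have "x \<alpha> \<in> possible_answers Q r \<sigma> \<alpha> x"
        using T_catches choices \<alpha> by blast
      then obtain \<beta>' q' where "successor_of \<beta>' \<alpha>" "bm_valid_move Q r \<beta>' p q'"
        "\<sigma> \<alpha> (restrict (p(\<beta>' := q')) {..<\<alpha>}) = x \<alpha>"
        unfolding possible_answers_def p_def by auto
      then have "\<exists>q. bm_valid_move Q r \<beta> p q \<and> \<sigma> \<alpha> (restrict (p(\<beta> := q)) {..<\<alpha>}) = x \<alpha>"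
        using successor_of_unique[OF suc] by blast
      from someI_ex[OF this]
      have "bm_valid_move Q r \<beta> p (p \<beta>) \<and> \<sigma> \<alpha> (restrict (p(\<beta> := p \<beta>)) {..<\<alpha>}) = x \<alpha>"
        using replay_nonempty[OF less.prems(2) suc, of Q r \<sigma> x] unfolding p_def by simp
      then show ?case using p_empty[OF \<alpha>_empty] unfolding \<alpha>_def by simp
    qed
    have pos: "bm_position Q r \<gamma> p" using good by (intro position) auto
    have reach: "\<exists>\<beta><\<gamma>. (x \<beta>, p \<alpha>) \<in> r" if \<alpha>: "\<alpha> < \<gamma>" "nonempty_turn \<alpha>" for \<alpha>
    proof -
      have "next_stage \<alpha> < \<gamma>" "\<alpha> < next_stage \<alpha>"
        using next_stage_less_limit[OF lim \<alpha>(1)] successor_next_stage(1)[OF \<alpha>(1)]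
        unfolding successor_of_def by auto
      then show ?thesis
        using pos good[OF \<alpha>] unfolding bm_position_def bm_valid_move_def by metis
    qed
    have "\<exists>\<beta><\<gamma>. (x \<beta>, p \<alpha>) \<in> r" if \<alpha>: "\<alpha> < \<gamma>" for \<alpha>
    proof (cases "empty_turn \<alpha>")
      case True
      note s = successor_next_stage(1)[OF \<alpha>] next_stage_less_limit[OF lim \<alpha>]
      have "nonempty_turn (next_stage \<alpha>)"
        using True s(1) by (rule empty_turn_nonempty_turn.after_empty)
      then obtain \<beta> where "\<beta> < \<gamma>" "(x \<beta>, p (next_stage \<alpha>)) \<in> r" using reach[OF s(2)] by blast
      moreover have "(p (next_stage \<alpha>), p \<alpha>) \<in> r"
        using pos s unfolding bm_position_def bm_valid_move_def successor_of_def by blast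
      ultimately show ?thesis using tr by blast
    next
      case False
      then show ?thesis using reach[OF \<alpha>] by (simp add: nonempty_turn_iff)
    qed
    then have "N p" using CN[OF \<open>C x\<close>] by blast
    then show False using win pos follows unfolding bm_winning_strategy_def by blast
  qed
  have "cut_wins_by_choices {W. max_antichain_below Q r X W} \<gamma> C T"
    unfolding cut_wins_by_choices_def
  proof (intro conjI allI impI)
    show "T \<alpha> x = T \<alpha> y" if "\<forall>\<xi><\<alpha>. x \<xi> = y \<xi>" for \<alpha> x y
      unfolding T_def possible_answers_cong[OF that] ..
  qed (use lose T_max in auto)
  then show ?thesis using X by (intro bexI[of _ X] exI[of _ T])
qed


section \<open>From a strategy for Cut to a strategy for Empty\<close>

text \<open>
  The stage of Empty at which the choice of round \<open>\<beta>\<close> is made: Empty moves at \<open>\<beta>\<close> or right after it.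
\<close>

definition settling_stage :: "'k::wellorder \<Rightarrow> 'k" where
  "settling_stage \<beta> = (if empty_turn \<beta> then \<beta> else next_stage \<beta>)"

lemma settling_stage:
  assumes "\<beta> \<le> \<alpha>" "empty_turn \<alpha>"
  shows "empty_turn (settling_stage \<beta>)" "\<beta> \<le> settling_stage \<beta>" "settling_stage \<beta> \<le> \<alpha>"
proof -
  have "empty_turn (next_stage \<beta>) \<and> \<beta> \<le> next_stage \<beta> \<and> next_stage \<beta> \<le> \<alpha>" if "\<not> empty_turn \<beta>"
  proof -
    have "\<beta> < \<alpha>" using assms that by (auto simp: le_less)
    note s = successor_next_stage[OF this]
    have "nonempty_turn \<beta>" using that by (simp add: nonempty_turn_iff)
    then have "empty_turn (next_stage \<beta>)"
      using s(1) by (rule empty_turn_nonempty_turn.after_nonempty)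
    then show ?thesis using s \<open>\<beta> < \<alpha>\<close> unfolding successor_of_def by auto
  qed
  then show "empty_turn (settling_stage \<beta>)" "\<beta> \<le> settling_stage \<beta>" "settling_stage \<beta> \<le> \<alpha>"
    using assms unfolding settling_stage_def by auto
qed

lemma settling_stage_less:
  assumes "\<beta> < \<alpha>" "nonempty_turn \<alpha>"
  shows "empty_turn (settling_stage \<beta>)" "\<beta> \<le> settling_stage \<beta>" "settling_stage \<beta> < \<alpha>"
proof -
  note s = successor_next_stage[OF assms(1)]
  have "empty_turn (next_stage \<beta>)" if "\<not> empty_turn \<beta>"
    using that s(1) empty_turn_nonempty_turn.after_nonempty nonempty_turn_iff by blast
  then show "empty_turn (settling_stage \<beta>)" "\<beta> \<le> settling_stage \<beta>" "settling_stage \<beta> < \<alpha>"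
    using s assms unfolding settling_stage_def successor_of_def
    by (auto simp: le_less nonempty_turn_iff)
qed

text \<open>
  The run of the cut and choose game that a Banach-Mazur play \<open>p\<close> stands for. Reading the choices off
  the moves, rather than recording them along the way, makes the strategy of Empty a function of
  the moves alone. If Cut played an antichain, then at most one member of it lies above the move.
\<close>

definition shadow_choices ::
  "'a rel \<Rightarrow> ('k::wellorder \<Rightarrow> ('k \<Rightarrow> 'a) \<Rightarrow> 'a set) \<Rightarrow> ('k \<Rightarrow> 'a) \<Rightarrow> 'k \<Rightarrow> 'a"
  where
  "shadow_choices r T p =
     course_rec (\<lambda>\<beta> x. SOME w. w \<in> T \<beta> x \<and> (p (settling_stage \<beta>), w) \<in> r)"

lemma shadow_choices:
  assumes "\<And>\<alpha> x y. (\<forall>\<xi><\<alpha>. x \<xi> = y \<xi>) \<Longrightarrow> T \<alpha> x = T \<alpha> y"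
  shows "shadow_choices r T p \<beta> =
    (SOME w. w \<in> T \<beta> (shadow_choices r T p) \<and> (p (settling_stage \<beta>), w) \<in> r)"
proof -
  have "T \<beta> (restrict x {..<\<beta>}) = T \<beta> x" for x by (rule assms) auto
  then show ?thesis unfolding shadow_choices_def by (subst course_rec) simp
qed

lemma shadow_choices_cong:
  assumes "\<And>\<alpha> x y. (\<forall>\<xi><\<alpha>. x \<xi> = y \<xi>) \<Longrightarrow> T \<alpha> x = T \<alpha> y"
    and "empty_turn \<alpha>" "\<And>\<xi>. \<xi> \<le> \<alpha> \<Longrightarrow> p \<xi> = p' \<xi>"
  shows "\<beta> \<le> \<alpha> \<Longrightarrow> shadow_choices r T p \<beta> = shadow_choices r T p' \<beta>"
proof (induction \<beta> rule: less_induct)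
  case (less \<beta>)
  then have "\<forall>\<xi><\<beta>. shadow_choices r T p \<xi> = shadow_choices r T p' \<xi>" by auto
  then have "T \<beta> (shadow_choices r T p) = T \<beta> (shadow_choices r T p')" by (rule assms(1))
  moreover have "p (settling_stage \<beta>) = p' (settling_stage \<beta>)"
    using assms(2,3) less.prems settling_stage(3) by blast
  ultimately show ?case
    using shadow_choices[of T r p \<beta>, OF assms(1)] shadow_choices[of T r p' \<beta>, OF assms(1)]
    by simp
qed

text \<open>
  The predicate \<open>good\<close> is the invariant that Empty maintains: her move at \<open>\<alpha>\<close> lies below a
  legitimate choice in every round up to \<open>\<alpha>\<close>. After a move of Nonempty at \<open>\<nu>\<close>, the rounds \<open>\<nu>\<close> and
  \<open>\<alpha> = \<nu> + 1\<close> are open. Empty first moves into the partition of round \<open>\<nu>\<close>, which determines the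
  partition of round \<open>\<alpha>\<close>, and then further down into the latter. Earlier rounds are settled, because
  Nonempty moved below the moves of Empty that settled them, also if \<open>\<nu>\<close> is a limit.
\<close>

lemma Empty_wins_if_Cut_wins:
  fixes \<gamma> :: "'k::wellorder"
  assumes pre: "preorder_on Q r" and lim: "limit_ordinal \<gamma>"
    and NC: "\<And>p x. N p \<Longrightarrow> (\<forall>\<delta><\<gamma>. \<exists>\<alpha><\<gamma>. \<forall>\<beta>\<le>\<delta>. (p \<alpha>, x \<beta>) \<in> r) \<Longrightarrow> C x"
    and X: "X \<in> Q" and win: "cut_wins_by_choices {W. max_antichain_below Q r X W} \<gamma> C T"
  shows "\<exists>\<sigma>. bm_winning_strategy Q r \<gamma> N \<sigma>"
proof -
  have tr: "\<And>a b c. (a, b) \<in> r \<Longrightarrow> (b, c) \<in> r \<Longrightarrow> (a, c) \<in> r"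
    and rQ: "\<And>a b. (a, b) \<in> r \<Longrightarrow> a \<in> Q" and "(X, X) \<in> r"
    using pre X unfolding preorder_on_def refl_on_def by (meson transD, blast+)
  have local: "\<And>\<alpha> x y. (\<forall>\<xi><\<alpha>. x \<xi> = y \<xi>) \<Longrightarrow> T \<alpha> x = T \<alpha> y"
    and legal: "\<And>\<alpha> x. \<alpha> < \<gamma> \<Longrightarrow> (\<forall>\<beta><\<alpha>. x \<beta> \<in> T \<beta> x) \<Longrightarrow> max_antichain_below Q r X (T \<alpha> x)"
    and lose: "\<And>x. (\<forall>\<beta><\<gamma>. x \<beta> \<in> T \<beta> x) \<Longrightarrow> \<not> C x"
    using win unfolding cut_wins_by_choices_def by blast+
  define ch where "ch p = shadow_choices r T p" for p
  have ch_mem: "ch p \<beta> \<in> T \<beta> (ch p) \<and> (p (settling_stage \<beta>), ch p \<beta>) \<in> r"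
    if "w \<in> T \<beta> (ch p)" "(p (settling_stage \<beta>), w) \<in> r" for p \<beta> w
    using someI[of "\<lambda>w. w \<in> T \<beta> (ch p) \<and> (p (settling_stage \<beta>), w) \<in> r" w] that
      shadow_choices[of T r p \<beta>, OF local] unfolding ch_def by simp
  have ch_cong: "ch p \<beta> = ch p' \<beta>"
    if "empty_turn \<alpha>" "\<And>\<xi>. \<xi> \<le> \<alpha> \<Longrightarrow> p \<xi> = p' \<xi>" "\<beta> \<le> \<alpha>" for p p' \<alpha> \<beta>
    unfolding ch_def using local that by (rule shadow_choices_cong)
  define good where "good \<alpha> p \<longleftrightarrow>
      (p \<alpha>, X) \<in> r \<and> (\<forall>\<beta>\<le>\<alpha>. ch p \<beta> \<in> T \<beta> (ch p) \<and> (p \<alpha>, ch p \<beta>) \<in> r)" for \<alpha> p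
  have good_cong: "good \<alpha> p = good \<alpha> p'"
    if "empty_turn \<alpha>" "\<And>\<xi>. \<xi> \<le> \<alpha> \<Longrightarrow> p \<xi> = p' \<xi>" for \<alpha> p p'
  proof -
    have eq: "ch p \<beta> = ch p' \<beta>" if "\<beta> \<le> \<alpha>" for \<beta>
      using ch_cong[OF \<open>empty_turn \<alpha>\<close>] that \<open>\<And>\<xi>. \<xi> \<le> \<alpha> \<Longrightarrow> p \<xi> = p' \<xi>\<close> by blast
    moreover have "T \<beta> (ch p) = T \<beta> (ch p')" if "\<beta> \<le> \<alpha>" for \<beta>
      using eq that by (intro local) auto
    ultimately show ?thesis using that(2)[of \<alpha>] unfolding good_def by auto
  qed
  have extend: "\<exists>q. bm_valid_move Q r \<alpha> p q \<and> good \<alpha> (p(\<alpha> := q))"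
    if \<alpha>: "\<alpha> < \<gamma>" "empty_turn \<alpha>" and pos: "bm_position Q r \<alpha> p"
      and old: "\<And>\<xi>. \<xi> < \<alpha> \<Longrightarrow> empty_turn \<xi> \<Longrightarrow> good \<xi> p" for \<alpha> p
    using \<alpha>(2)
  proof (cases rule: empty_turn_cases)
    case 1
    then have none: "\<not> \<xi> < \<alpha>" for \<xi> by (simp add: not_less)
    then obtain w s where w: "w \<in> T \<alpha> (ch p)" "(s, X) \<in> r" "(s, w) \<in> r"
      using max_antichain_below_refines[OF pre legal[OF \<alpha>(1)] \<open>(X, X) \<in> r\<close>] by blast
    define p' where "p' = p(\<alpha> := s)"
    have "T \<alpha> (ch p') = T \<alpha> (ch p)" using none by (intro local) auto
    then have "ch p' \<alpha> \<in> T \<alpha> (ch p') \<and> (p' (settling_stage \<alpha>), ch p' \<alpha>) \<in> r"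
      using w \<alpha>(2) by (intro ch_mem[of w]) (auto simp: p'_def settling_stage_def)
    then have "good \<alpha> p'"
      using w(2) \<alpha>(2) none unfolding good_def by (auto simp: p'_def settling_stage_def le_less)
    moreover have "bm_valid_move Q r \<alpha> p s"
      using none rQ[OF w(2)] unfolding bm_valid_move_def by blast
    ultimately show ?thesis unfolding p'_def by blast
  next
    case (2 \<nu>)
    have "\<nu> < \<alpha>" using 2 unfolding successor_of_def by simp
    have valid: "(p \<nu>, p \<xi>) \<in> r" if "\<xi> < \<nu>" for \<xi>
      using pos \<open>\<nu> < \<alpha>\<close> that unfolding bm_position_def bm_valid_move_def by blast
    have settled: "ch p \<beta> \<in> T \<beta> (ch p) \<and> (p \<nu>, ch p \<beta>) \<in> r \<and> (p \<nu>, X) \<in> r" if "\<beta> < \<nu>" for \<beta>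
    proof -
      note s = settling_stage_less[OF that 2(1)]
      have "good (settling_stage \<beta>) p" using s \<open>\<nu> < \<alpha>\<close> by (intro old) auto
      then show ?thesis using s(2) valid[OF s(3)] tr unfolding good_def by blast
    qed
    have "\<exists>\<beta>. \<beta> < \<nu>"
      using 2(1) empty_turn_nonempty_turn.start nonempty_turn_iff by (meson not_less)
    then have "(p \<nu>, X) \<in> r" using settled by blast
    then obtain w s where w: "w \<in> T \<nu> (ch p)" "(s, p \<nu>) \<in> r" "(s, w) \<in> r"
      using max_antichain_below_refines[OF pre legal[of \<nu> "ch p"]] settled \<open>\<nu> < \<alpha>\<close> \<alpha>(1)
      by (meson less_trans)
    define x where "x = (ch p)(\<nu> := w)"
    have T\<nu>: "T \<beta> x = T \<beta> (ch p)" if "\<beta> \<le> \<nu>" for \<beta>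
      using that by (intro local) (auto simp: x_def)
    have "\<forall>\<beta><\<alpha>. x \<beta> \<in> T \<beta> x"
      using T\<nu> settled w(1) less_successor_iff[OF 2(2)] by (auto simp: x_def)
    moreover have "(s, X) \<in> r" using w(2) \<open>(p \<nu>, X) \<in> r\<close> tr by blast
    ultimately obtain v t where v: "v \<in> T \<alpha> x" "(t, s) \<in> r" "(t, v) \<in> r"
      using max_antichain_below_refines[OF pre legal[OF \<alpha>(1)]] by blast
    define p' where "p' = p(\<alpha> := t)"
    have below: "ch p' \<beta> = x \<beta>" if "\<beta> < \<nu>" for \<beta>
    proof -
      note s = settling_stage_less[OF that 2(1)]
      have "ch p' \<beta> = ch p \<beta>"
        using s \<open>\<nu> < \<alpha>\<close> by (intro ch_cong[OF s(1)]) (auto simp: p'_def)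
      then show ?thesis using that by (auto simp: x_def)
    qed
    then have T\<nu>': "T \<nu> (ch p') = T \<nu> (ch p)"
      using T\<nu>[of \<nu>] local[of \<nu> "ch p'" x] by simp
    have settle: "settling_stage \<nu> = \<alpha>" "settling_stage \<alpha> = \<alpha>"
      using 2 \<alpha>(2) next_stage_eq[OF 2(2)] by (auto simp: settling_stage_def nonempty_turn_iff)
    have tw: "(t, w) \<in> r" using v(2) w(3) tr by blast
    then have \<nu>: "ch p' \<nu> \<in> T \<nu> (ch p) \<and> (t, ch p' \<nu>) \<in> r"
      using ch_mem[of w \<nu> p'] w(1) unfolding T\<nu>' settle by (simp add: p'_def)
    have "max_antichain_below Q r X (T \<nu> (ch p))"
      using settled \<open>\<nu> < \<alpha>\<close> \<alpha>(1) by (intro legal) auto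
    \<comment> \<open>The choice read off from \<open>t\<close> in round \<open>\<nu>\<close> is the intended \<open>w\<close>, on which the partition of
      round \<open>\<alpha>\<close> depends: an antichain has only one member above \<open>t\<close>.\<close>
    then have "ch p' \<nu> = w"
      using \<nu> w(1) tw antichain_below_unique[OF pre] by blast
    then have agree: "ch p' \<beta> = x \<beta>" if "\<beta> < \<alpha>" for \<beta>
      using that below less_successor_iff[OF 2(2)] by (auto simp: x_def)
    then have "T \<alpha> (ch p') = T \<alpha> x" by (intro local) auto
    then have top: "ch p' \<alpha> \<in> T \<alpha> (ch p') \<and> (t, ch p' \<alpha>) \<in> r"
      using ch_mem[of v \<alpha> p'] v unfolding settle by (simp add: p'_def)
    have t\<nu>: "(t, p \<nu>) \<in> r" using v(2) w(2) tr by blast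
    have "ch p' \<beta> \<in> T \<beta> (ch p') \<and> (t, ch p' \<beta>) \<in> r" if "\<beta> < \<alpha>" for \<beta>
    proof -
      have "\<forall>\<xi><\<beta>. ch p' \<xi> = x \<xi>"
      proof (intro allI impI)
        fix \<xi> assume "\<xi> < \<beta>"
        then show "ch p' \<xi> = x \<xi>" using that by (intro agree) simp
      qed
      then have T\<beta>: "T \<beta> (ch p') = T \<beta> x" by (rule local)
      consider "\<beta> < \<nu>" | "\<beta> = \<nu>"
        using \<open>\<beta> < \<alpha>\<close> less_successor_iff[OF 2(2), of \<beta>] by auto
      then show ?thesis
      proof cases
        case 1
        then have "ch p' \<beta> = ch p \<beta>" using below[OF 1] by (auto simp: x_def)
        moreover have "(t, ch p \<beta>) \<in> r" using settled[OF 1] t\<nu> tr by blast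
        ultimately show ?thesis using T\<beta> T\<nu>[of \<beta>] settled[OF 1] 1 by simp
      next
        case 2
        then show ?thesis using \<nu> T\<nu>' by (simp only:)
      qed
    qed
    moreover have "(t, X) \<in> r" using v(2) \<open>(s, X) \<in> r\<close> tr by blast
    ultimately have "good \<alpha> p'"
      using top unfolding good_def by (auto simp: p'_def le_less)
    moreover have "bm_valid_move Q r \<alpha> p t"
      using t\<nu> rQ[OF t\<nu>] valid tr less_successor_iff[OF 2(2)] unfolding bm_valid_move_def by blast
    ultimately show ?thesis unfolding p'_def by blast
  qed
  define \<sigma> where "\<sigma> \<alpha> p = (SOME q. bm_valid_move Q r \<alpha> p q \<and> good \<alpha> (p(\<alpha> := q)))" for \<alpha> p
  have \<sigma>_restrict: "\<sigma> \<alpha> (restrict p {..<\<alpha>}) = \<sigma> \<alpha> p" if "empty_turn \<alpha>" for \<alpha> p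
  proof -
    have "good \<alpha> ((restrict p {..<\<alpha>})(\<alpha> := q)) = good \<alpha> (p(\<alpha> := q))" for q
      by (rule good_cong[OF that]) (auto simp: le_less)
    moreover have "bm_valid_move Q r \<alpha> (restrict p {..<\<alpha>}) = bm_valid_move Q r \<alpha> p"
      by (rule bm_valid_move_cong) simp
    ultimately show ?thesis unfolding \<sigma>_def by simp
  qed
  have \<sigma>: "bm_valid_move Q r \<alpha> p (\<sigma> \<alpha> p) \<and> good \<alpha> (p(\<alpha> := \<sigma> \<alpha> p))"
    if "\<alpha> < \<gamma>" "empty_turn \<alpha>" "bm_position Q r \<alpha> p"
      "\<And>\<xi>. \<xi> < \<alpha> \<Longrightarrow> empty_turn \<xi> \<Longrightarrow> good \<xi> p" for \<alpha> p
    unfolding \<sigma>_def using extend[OF that] by (rule someI_ex)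
  have all_good: "good \<xi> p"
    if "\<alpha> \<le> \<gamma>" "bm_position Q r \<alpha> p" "bm_follows \<sigma> \<alpha> p" "\<xi> < \<alpha>" "empty_turn \<xi>" for \<alpha> p \<xi>
    using that(4,5)
  proof (induction \<xi> rule: less_induct)
    case (less \<xi>)
    have "bm_position Q r \<xi> p" using that(2) less.prems(1) unfolding bm_position_def by auto
    moreover have "\<And>\<eta>. \<eta> < \<xi> \<Longrightarrow> empty_turn \<eta> \<Longrightarrow> good \<eta> p" using less by auto
    ultimately have "good \<xi> (p(\<xi> := \<sigma> \<xi> p))"
      using \<sigma>[OF _ less.prems(2)] less.prems(1) that(1) by auto
    moreover have "p \<xi> = \<sigma> \<xi> p"
      using that(3) less.prems \<sigma>_restrict unfolding bm_follows_def by metis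
    ultimately show ?case by (metis fun_upd_triv)
  qed
  have "bm_winning_strategy Q r \<gamma> N \<sigma>"
    unfolding bm_winning_strategy_def
  proof (intro conjI allI impI)
    fix \<alpha> p assume "\<alpha> < \<gamma>" and p: "empty_turn \<alpha> \<and> bm_position Q r \<alpha> p \<and> bm_follows \<sigma> \<alpha> p"
    then show "bm_valid_move Q r \<alpha> p (\<sigma> \<alpha> (restrict p {..<\<alpha>}))"
      using \<sigma>[of \<alpha> p] all_good[of \<alpha> p] \<sigma>_restrict[of \<alpha> p] by simp
  next
    fix p assume p: "bm_position Q r \<gamma> p \<and> bm_follows \<sigma> \<gamma> p"
    have settled: "\<exists>\<alpha><\<gamma>. \<beta> \<le> \<alpha> \<and> good \<alpha> p" if "\<beta> < \<gamma>" for \<beta>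
    proof -
      note s = successor_next_stage(1)[OF that] next_stage_less_limit[OF lim that]
      have "\<beta> \<le> next_stage \<beta>" using s(1) unfolding successor_of_def by (blast intro: less_imp_le)
      moreover have "empty_turn \<beta> \<or> empty_turn (next_stage \<beta>)"
        using s(1) empty_turn_nonempty_turn.after_nonempty nonempty_turn_iff by blast
      ultimately show ?thesis using all_good[of \<gamma> p] p s(2) that by blast
    qed
    then have "\<not> C (ch p)" by (intro lose) (auto simp: good_def)
    moreover have "\<forall>\<delta><\<gamma>. \<exists>\<alpha><\<gamma>. \<forall>\<beta>\<le>\<delta>. (p \<alpha>, ch p \<beta>) \<in> r"
      using settled unfolding good_def by (meson order_trans)
    ultimately show "\<not> N p" using NC by blast
  qed
  then show ?thesis by (rule exI[of _ \<sigma>])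
qed


section \<open>The two games of ideals and of posets\<close>

text \<open>
  A win passes from choices to moves if below each move there is a choice, and from moves to choices
  if below each initial segment of the choices there is a move. It matters that a single move
  serves the whole segment: for ideals, this makes the intersection of the segment positive.
\<close>

theorem Empty_wins_iff_Cut_wins:
  fixes \<gamma> :: "'k::wellorder"
  assumes pre: "preorder_on Q r" and lim: "limit_ordinal \<gamma>"
    and bound: "\<And>x \<delta>. C x \<Longrightarrow> \<delta> < \<gamma> \<Longrightarrow> \<exists>q\<in>Q. \<forall>\<beta>\<le>\<delta>. (q, x \<beta>) \<in> r"
    and CN: "\<And>p x. C x \<Longrightarrow> (\<forall>\<alpha><\<gamma>. \<exists>\<beta><\<gamma>. (x \<beta>, p \<alpha>) \<in> r) \<Longrightarrow> N p"
    and NC: "\<And>p x. N p \<Longrightarrow> (\<forall>\<delta><\<gamma>. \<exists>\<alpha><\<gamma>. \<forall>\<beta>\<le>\<delta>. (p \<alpha>, x \<beta>) \<in> r) \<Longrightarrow> C x"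
  shows "(\<exists>\<sigma>. bm_winning_strategy Q r \<gamma> N \<sigma>) \<longleftrightarrow>
    (\<exists>X\<in>Q. \<exists>\<tau>. cc_winning_strategy {W. max_antichain_below Q r X W} \<gamma> C \<tau>)"
  unfolding cc_winning_strategy_iff_by_choices
proof
  assume "\<exists>\<sigma>. bm_winning_strategy Q r \<gamma> N \<sigma>"
  then obtain \<sigma> where \<sigma>: "bm_winning_strategy Q r \<gamma> N \<sigma>" ..
  show "\<exists>X\<in>Q. \<exists>T. cut_wins_by_choices {W. max_antichain_below Q r X W} \<gamma> C T"
  proof (rule Cut_wins_if_Empty_wins[where N = N and C = C and \<sigma> = \<sigma>, OF pre lim])
    show "\<exists>q\<in>Q. \<forall>\<beta>\<le>\<delta>. (q, x \<beta>) \<in> r" if "C x" "\<delta> < \<gamma>" for x \<delta>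
      by (rule bound[OF that])
    show "N p" if "C x" "\<forall>\<alpha><\<gamma>. \<exists>\<beta><\<gamma>. (x \<beta>, p \<alpha>) \<in> r" for p x
      by (rule CN[OF that])
  qed (rule \<sigma>)
next
  assume "\<exists>X\<in>Q. \<exists>T. cut_wins_by_choices {W. max_antichain_below Q r X W} \<gamma> C T"
  then obtain X T where X: "X \<in> Q"
    and T: "cut_wins_by_choices {W. max_antichain_below Q r X W} \<gamma> C T" by blast
  show "\<exists>\<sigma>. bm_winning_strategy Q r \<gamma> N \<sigma>"
  proof (rule Empty_wins_if_Cut_wins[where N = N and C = C and X = X and T = T, OF pre lim])
    show "C x" if "N p" "\<forall>\<delta><\<gamma>. \<exists>\<alpha><\<gamma>. \<forall>\<beta>\<le>\<delta>. (p \<alpha>, x \<beta>) \<in> r" for p x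
      by (rule NC[OF that])
  qed (rule X, rule T)
qed

text \<open>
  Two positive sets are compatible exactly if their intersection is positive, since the
  intersection is then itself a common lower bound.
\<close>

lemma ideal_partition_eq_max_antichain_below:
  assumes I: "set_ideal I" and X: "X \<in> positive_sets I"
  shows "ideal_partition I X W \<longleftrightarrow>
    max_antichain_below (positive_sets I) (relation_of (\<subseteq>) (positive_sets I)) X W"
proof -
  let ?P = "positive_sets I"
  have compat: "compatible ?P (relation_of (\<subseteq>) ?P) A B \<longleftrightarrow> A \<inter> B \<notin> I" if "A \<in> ?P" "B \<in> ?P" for A B
  proof -
    have "A \<inter> B \<notin> I" if "S \<notin> I" "S \<subseteq> A" "S \<subseteq> B" for S
      using I that unfolding set_ideal_def by (meson Int_greatest)
    then show ?thesis
      using that unfolding compatible_def relation_of_def positive_sets_def by auto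
  qed
  have below: "{A \<in> ?P. (A, X) \<in> relation_of (\<subseteq>) ?P} = Pow X \<inter> ?P"
    using X by (auto simp: relation_of_def)
  have "almost_disjoint_family I X W = antichain_below ?P (relation_of (\<subseteq>) ?P) X W" for W
    unfolding almost_disjoint_family_def antichain_below_def below using compat by blast
  then show ?thesis unfolding ideal_partition_def max_antichain_below_def by simp
qed

text \<open>
  The demand that the choices up to each stage have a positive intersection is what makes this
  an instance: the intersection is the lower bound that Nonempty needs as a legal move. For the full
  length no positive set is demanded; there, a point common to all terms of one sequence lies
  in every term of the other, which contains a term of the first.
\<close>

lemma empty_wins_ideal_game_iff:
  fixes \<gamma> :: "'k::wellorder"
  assumes I: "set_ideal I" and lim: "limit_ordinal \<gamma>"
  shows "empty_wins_ideal_game I \<gamma> \<longleftrightarrow> (\<exists>X\<in>positive_sets I. cut_wins_ideal_game X I \<gamma>)"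
proof -
  let ?P = "positive_sets I"
  let ?r = "relation_of (\<subseteq>) ?P"
  let ?C = "\<lambda>x. (\<forall>\<delta><\<gamma>. (\<Inter>\<alpha>\<in>{..\<delta>}. x \<alpha>) \<in> ?P) \<and> (\<Inter>\<alpha>\<in>{..<\<gamma>}. x \<alpha>) \<noteq> {}"
  let ?N = "\<lambda>p. (\<Inter>\<alpha>\<in>{..<\<gamma>}. p \<alpha>) \<noteq> {}"
  have up: "B \<in> ?P" if "A \<in> ?P" "A \<subseteq> B" for A B
    using I that unfolding set_ideal_def positive_sets_def by blast
  have r: "(A, B) \<in> ?r \<longleftrightarrow> A \<in> ?P \<and> B \<in> ?P \<and> A \<subseteq> B" for A B
    by (auto simp: relation_of_def)
  have "(\<exists>\<sigma>. bm_winning_strategy ?P ?r \<gamma> ?N \<sigma>) \<longleftrightarrow>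
    (\<exists>X\<in>?P. \<exists>\<tau>. cc_winning_strategy {W. max_antichain_below ?P ?r X W} \<gamma> ?C \<tau>)"
  proof (rule Empty_wins_iff_Cut_wins[OF _ lim])
    show "preorder_on ?P ?r"
      by (auto simp: preorder_on_def refl_on_def trans_def r)
  next
    fix x \<delta> assume "?C x" "\<delta> < \<gamma>"
    then have pos: "(\<Inter>\<alpha>\<in>{..\<delta>}. x \<alpha>) \<in> ?P" by blast
    have "((\<Inter>\<alpha>\<in>{..\<delta>}. x \<alpha>), x \<beta>) \<in> ?r" if "\<beta> \<le> \<delta>" for \<beta>
    proof -
      have "(\<Inter>\<alpha>\<in>{..\<delta>}. x \<alpha>) \<subseteq> x \<beta>" using that by auto
      then show ?thesis using pos up unfolding r by blast
    qed
    then show "\<exists>q\<in>?P. \<forall>\<beta>\<le>\<delta>. (q, x \<beta>) \<in> ?r" using pos by blast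
  next
    fix p x assume "?C x" and "\<forall>\<alpha><\<gamma>. \<exists>\<beta><\<gamma>. (x \<beta>, p \<alpha>) \<in> ?r"
    then have "(\<Inter>\<alpha>\<in>{..<\<gamma>}. x \<alpha>) \<subseteq> (\<Inter>\<alpha>\<in>{..<\<gamma>}. p \<alpha>)" unfolding r by fastforce
    then show "?N p" using \<open>?C x\<close> by blast
  next
    fix p x assume "?N p" and below: "\<forall>\<delta><\<gamma>. \<exists>\<alpha><\<gamma>. \<forall>\<beta>\<le>\<delta>. (p \<alpha>, x \<beta>) \<in> ?r"
    have "(\<Inter>\<alpha>\<in>{..\<delta>}. x \<alpha>) \<in> ?P" if \<delta>: "\<delta> < \<gamma>" for \<delta>
    proof -
      obtain \<alpha> where \<alpha>: "\<forall>\<beta>\<le>\<delta>. (p \<alpha>, x \<beta>) \<in> ?r" using below \<delta> by blast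
      then have "p \<alpha> \<in> ?P" "p \<alpha> \<subseteq> (\<Inter>\<alpha>\<in>{..\<delta>}. x \<alpha>)" unfolding r by auto
      then show ?thesis by (rule up)
    qed
    moreover have "(\<Inter>\<alpha>\<in>{..<\<gamma>}. p \<alpha>) \<subseteq> (\<Inter>\<alpha>\<in>{..<\<gamma>}. x \<alpha>)"
      using below unfolding r by fastforce
    ultimately show "?C x" using \<open>?N p\<close> by blast
  qed
  moreover have "{W. ideal_partition I X W} = {W. max_antichain_below ?P ?r X W}" if "X \<in> ?P" for X
    using ideal_partition_eq_max_antichain_below[OF I that] by simp
  ultimately show ?thesis
    unfolding empty_wins_ideal_game_def cut_wins_ideal_game_def by (simp only: cong: bex_cong)
qed

lemma empty_wins_poset_game_iff:
  fixes \<gamma> :: "'k::wellorder"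
  assumes "preorder_on Q r" and "limit_ordinal \<gamma>"
  shows "empty_wins_poset_game Q r \<gamma> \<longleftrightarrow> (\<exists>X\<in>Q. cut_wins_poset_game X Q r \<gamma>)"
  unfolding empty_wins_poset_game_def cut_wins_poset_game_def
proof (rule Empty_wins_iff_Cut_wins[OF assms])
  have tr: "\<And>a b c. (a, b) \<in> r \<Longrightarrow> (b, c) \<in> r \<Longrightarrow> (a, c) \<in> r"
    using assms(1) unfolding preorder_on_def by (meson transD)
  show "\<exists>q\<in>Q. \<forall>\<beta>\<le>\<delta>. (q, x \<beta>) \<in> r" if "\<exists>q\<in>Q. \<forall>\<alpha><\<gamma>. (q, x \<alpha>) \<in> r" "\<delta> < \<gamma>" for x \<delta>
    using that by (meson le_less_trans)
  show "\<exists>q\<in>Q. \<forall>\<alpha><\<gamma>. (q, p \<alpha>) \<in> r"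
    if "\<exists>q\<in>Q. \<forall>\<alpha><\<gamma>. (q, x \<alpha>) \<in> r" "\<forall>\<alpha><\<gamma>. \<exists>\<beta><\<gamma>. (x \<beta>, p \<alpha>) \<in> r" for p x
    using that tr by blast
  show "\<exists>q\<in>Q. \<forall>\<alpha><\<gamma>. (q, x \<alpha>) \<in> r"
    if "\<exists>q\<in>Q. \<forall>\<alpha><\<gamma>. (q, p \<alpha>) \<in> r" "\<forall>\<delta><\<gamma>. \<exists>\<alpha><\<gamma>. \<forall>\<beta>\<le>\<delta>. (p \<alpha>, x \<beta>) \<in> r" for p x
    using that tr by (meson order_refl)
qed

theorem theorem7p3:
  fixes I :: "'k::wellorder set set" and \<gamma> :: 'k
    and Q :: "'q set" and r :: "'q rel"
  assumes "Card_order (type_order :: 'k rel)"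
    and "regularCard (type_order :: 'k rel)"
    and "natLeq <o (type_order :: 'k rel)"
    and "set_ideal I"
    and "limit_ordinal \<gamma>"
    and "partial_order_on Q r"
    and "\<exists>m\<in>Q. \<forall>q\<in>Q. (m, q) \<in> r \<longrightarrow> q = m"
  shows "(empty_wins_ideal_game I \<gamma> \<longleftrightarrow> (\<exists>X\<in>positive_sets I. cut_wins_ideal_game X I \<gamma>)) \<and>
         (empty_wins_poset_game Q r \<gamma> \<longleftrightarrow> (\<exists>X\<in>Q. cut_wins_poset_game X Q r \<gamma>))"
  using empty_wins_ideal_game_iff[OF assms(4,5)] empty_wins_poset_game_iff[OF _ assms(5), of Q r]
    assms(6) unfolding partial_order_on_def by blast

end
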